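(* Consider sequences of real numbers indexed by $\mathbb N=\{1,2,3,\dots\}$, with termwise operations, and the relations $=_{\mathcal F}$, $<_{\mathcal F}$ (eventual equality and eventual strict inequality), $<<$, $>>$ and $\doteq$ defined in the context. Let $N$, $P$, $S$, and, for $m\in\mathbb N$, $N_m$ and $\overline{m}$ be the sequences defined in the context. Then the following hold. 1. For every $m\in\mathbb N$: $\overline{m} =_{\mathcal F} N - N_m$. 2. For every real $e$ with $0<e<1$, the sequence of partial sums $\left(\frac{1-e^n}{1-e}\right)_{n\in\mathbb N}$ of the series $1+e+e^2+e^3+\cdots$ is infinitely close to the constant sequence with value $\frac{1}{1-e}$, i.e. $\left(\frac{1-e^n}{1-e}\right)_n \doteq \left(\frac{1}{1-e}\right)_n$. 3. $P <_{\mathcal F} S$ and $S >> P$. 4. For all $r,s\in\mathbb R$ with $s\neq 0$, the termwise quotient of $r\cdot N$ by $s\cdot N$ is $=_{\mathcal F}$ to the constant sequence with value $r/s$; moreover $N^2 >> N$ and $N^3 >> N^2$.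
   Context: Infinite series are interpreted as sequences of their partial sums: the series $a_1+a_2+a_3+\cdots$ (with $a_i\in\mathbb R$) corresponds to $(s_n)_{n\in\mathbb N}\in\mathbb R^{\mathbb N}$ with $s_n=a_1+\dots+a_n$. A real number $r$ is interpreted as the constant sequence $(r,r,r,\dots)$; $\mathbf 1=(1,1,1,\dots)$. Sums, differences, products, multiples by a real number and quotients (when defined) of sequences are taken termwise. Relations on $\mathbb R^{\mathbb N}$: - $(a_n)=_{\mathcal F}(b_n)$ iff there is $m\in\mathbb N$ such that $a_n=b_n$ for all $n>m$. - $(a_n)<_{\mathcal F}(b_n)$ iff there is $m\in\mathbb N$ such that $a_n<b_n$ for all $n>m$. - $(a_n)<<(b_n)$ ("$(a_n)$ is infinitely smaller than $(b_n)$"), also written $(b_n)>>(a_n)$, iff for every $k\in\mathbb N$, $k\cdot(a_n)<_{\mathcal F}(b_n)$. - $(a_n)$ is infinitely small iff $(|a_n|)<<\mathbf 1$. - $(a_n)\doteq(b_n)$ ("infinitely close") iff $(a_n-b_n)$ is infinitely small. Particular sequences: - $N=(n)_{n\in\mathbb N}=(1,2,3,\dots)$, corresponding to $1+1+1+\cdots$. - For $m\in\mathbb N$, $N_m=(0,\dots,0,1,2,3,\dots)$ with $m$ initial zeros (the series of ones with the first $m$ terms omitted), i.e. its $n$-th term is $\max(n-m,0)$. - For $m\in\mathbb N$, $\overline{m}=(1,2,\dots,m,m,m,\dots)$, i.e. its $n$-th term is $\min(n,m)$ (corresponding to the sum of $m$ ones). - $P=\left(\frac{n(n+1)}{2}\right)_{n}$,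 corresponding to $1+2+3+\cdots$. - $S=\left(\frac{n(n+1)(2n+1)}{6}\right)_{n}$, corresponding to $1+4+9+16+\cdots$. - $r\cdot N=(rn)_n$ for $r\in\mathbb R$; $N^2=N\cdot N=(n^2)_n$; $N^3=(n^3)_n$. *)

theory Defs
  imports
    Complex_Main
    "HOL-Library.Function_Algebras"
    "HOL-Library.Function_Division"
begin

text \<open>
  Sequences are indexed by the positive integers. They are encoded as functions on
  \<^typ>\<open>nat\<close> of which only the values at positive arguments are meaningful: the
  value at \<open>0\<close> is junk, and all the relations below ignore it. Bounds \<open>m\<close> and multipliers
  \<open>k\<close> range over the positive integers as well.
  Termwise sums, differences, products, powers and quotients come from the
  function-space instances of the library.
\<close>

type_synonym rseq = "nat \<Rightarrow> real"

definition const_seq :: "real \<Rightarrow> rseq"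
  where "const_seq r = (\<lambda>n. r)"

definition partial_sums :: "rseq \<Rightarrow> rseq"
  where "partial_sums a = (\<lambda>n. \<Sum>i = 1..n. a i)"

definition eq_F :: "rseq \<Rightarrow> rseq \<Rightarrow> bool"  (infix \<open>=\<^sub>F\<close> 50)
  where "a =\<^sub>F b \<longleftrightarrow> (\<exists>m\<ge>1. \<forall>n>m. a n = b n)"

definition less_F :: "rseq \<Rightarrow> rseq \<Rightarrow> bool"  (infix \<open><\<^sub>F\<close> 50)
  where "a <\<^sub>F b \<longleftrightarrow> (\<exists>m\<ge>1. \<forall>n>m. a n < b n)"

definition inf_smaller :: "rseq \<Rightarrow> rseq \<Rightarrow> bool"  (infix \<open>\<lless>\<close> 50)
  where "a \<lless> b \<longleftrightarrow> (\<forall>k::nat. k \<ge> 1 \<longrightarrow> const_seq (real k) * a <\<^sub>F b)"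

abbreviation inf_larger :: "rseq \<Rightarrow> rseq \<Rightarrow> bool"  (infix \<open>\<ggreater>\<close> 50)
  where "b \<ggreater> a \<equiv> a \<lless> b"

definition infinitely_small :: "rseq \<Rightarrow> bool"
  where "infinitely_small a \<longleftrightarrow> (\<lambda>n. \<bar>a n\<bar>) \<lless> const_seq 1"

definition inf_close :: "rseq \<Rightarrow> rseq \<Rightarrow> bool"  (infix \<open>\<doteq>\<close> 50)
  where "a \<doteq> b \<longleftrightarrow> infinitely_small (a - b)"

definition seq_N :: rseq
  where "seq_N = (\<lambda>n. real n)"

definition seq_N_omit :: "nat \<Rightarrow> rseq"
  where "seq_N_omit m = (\<lambda>n. max (real n - real m) 0)"

definition seq_bar :: "nat \<Rightarrow> rseq"
  where "seq_bar m = (\<lambda>n. real (min n m))"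

definition seq_P :: rseq
  where "seq_P = (\<lambda>n. real n * (real n + 1) / 2)"

definition seq_S :: rseq
  where "seq_S = (\<lambda>n. real n * (real n + 1) * (2 * real n + 1) / 6)"

text \<open>The closed forms are the partial sums of the series they stand for.\<close>

lemma seq_N_partial_sums: "seq_N = partial_sums (\<lambda>i. 1)"
  by (simp add: seq_N_def partial_sums_def)

lemma seq_N_omit_partial_sums: "seq_N_omit m = partial_sums (\<lambda>i. if i \<le> m then 0 else 1)"
proof
  fix n show "seq_N_omit m n = partial_sums (\<lambda>i. if i \<le> m then 0 else 1) n"
    by (induction n) (auto simp: seq_N_omit_def partial_sums_def)
qed

lemma seq_bar_partial_sums: "seq_bar m = partial_sums (\<lambda>i. if i \<le> m then 1 else 0)"
proof
  fix n show "seq_bar m n = partial_sums (\<lambda>i. if i \<le> m then 1 else 0) n"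
    by (induction n) (auto simp: seq_bar_def partial_sums_def)
qed

lemma seq_P_partial_sums: "seq_P = partial_sums (\<lambda>i. real i)"
proof
  fix n show "seq_P n = partial_sums (\<lambda>i. real i) n"
    by (induction n) (simp_all add: seq_P_def partial_sums_def field_simps)
qed

lemma seq_S_partial_sums: "seq_S = partial_sums (\<lambda>i. (real i)\<^sup>2)"
proof
  fix n show "seq_S n = partial_sums (\<lambda>i. (real i)\<^sup>2) n"
    by (induction n) (simp_all add: seq_S_def partial_sums_def field_simps power2_eq_square)
qed

end

theory Submission
  imports Defs
begin

text \<open>All the relations speak of what holds for all large indices, so they translate into the
  filter \<open>sequentially\<close>, and limits decide them. A null sequence is infinitely small
  (\<open>LIMSEQ_0_imp_infinitely_small\<close>), which settles the geometric series because
  \<open>e ^ n\<close> tends to 0. If \<open>b = c * a\<close> with \<open>a\<close> eventually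
  positive and \<open>c\<close> tending to infinity, then \<open>c\<close> exceeds every multiplier
  \<open>k\<close>, so \<open>a \<lless> b\<close> (\<open>inf_smaller_unbounded_mult\<close>). This
  covers the powers of \<open>seq_N\<close>, with factor \<open>n\<close>, and \<open>seq_P\<close>
  against \<open>seq_S\<close>, with factor \<open>(2n+1)/3\<close>. The other claims are pointwise
  identities.\<close>

lemma eventually_sequentially_gt: "eventually P sequentially \<longleftrightarrow> (\<exists>m\<ge>1. \<forall>n>m. P n)"
proof
  assume "eventually P sequentially"
  then obtain M where "\<forall>n\<ge>M. P n"
    by (auto simp: eventually_sequentially)
  then show "\<exists>m\<ge>1. \<forall>n>m. P n"
    \<comment> \<open>The maximum with 1 makes the bound a positive integer.\<close>
    by (intro exI[of _ "max 1 M"]) auto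
next
  assume "\<exists>m\<ge>1. \<forall>n>m. P n"
  then show "eventually P sequentially"
    by (auto simp: eventually_at_top_dense)
qed

lemma eq_F_iff: "a =\<^sub>F b \<longleftrightarrow> (\<forall>\<^sub>F n in sequentially. a n = b n)"
  by (simp add: eq_F_def eventually_sequentially_gt)

lemma less_F_iff: "a <\<^sub>F b \<longleftrightarrow> (\<forall>\<^sub>F n in sequentially. a n < b n)"
  by (simp add: less_F_def eventually_sequentially_gt)

lemma inf_smaller_iff:
  "a \<lless> b \<longleftrightarrow> (\<forall>k::nat. k \<ge> 1 \<longrightarrow> (\<forall>\<^sub>F n in sequentially. real k * a n < b n))"
  by (simp add: inf_smaller_def less_F_iff const_seq_def)

text \<open>This is the case of multiplier 1.\<close>

lemma inf_smaller_imp_less_F: "a \<lless> b \<Longrightarrow> a <\<^sub>F b"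
  unfolding inf_smaller_iff less_F_iff by (drule spec[of _ 1]) simp

lemma LIMSEQ_0_imp_infinitely_small:
  assumes "a \<longlonglongrightarrow> 0"
  shows "infinitely_small a"
  unfolding infinitely_small_def inf_smaller_iff const_seq_def
proof (intro allI impI)
  fix k :: nat assume "k \<ge> 1"
  \<comment> \<open>A fixed multiplier keeps the limit at 0, hence the terms eventually below
    1.\<close>
  have "(\<lambda>n. real k * \<bar>a n\<bar>) \<longlonglongrightarrow> real k * \<bar>0\<bar>"
    by (intro tendsto_intros assms)
  then show "\<forall>\<^sub>F n in sequentially. real k * \<bar>a n\<bar> < 1"
    by (rule order_tendstoD) simp
qed

lemma inf_smaller_unbounded_mult:
  assumes "\<forall>\<^sub>F n in sequentially. a n > 0"
    and "filterlim c at_top sequentially"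
    and "\<forall>\<^sub>F n in sequentially. b n = c n * a n"
  shows "a \<lless> b"
  unfolding inf_smaller_iff
proof (intro allI impI)
  fix k :: nat
  have "\<forall>\<^sub>F n in sequentially. c n > real k"
    using assms(2) by (simp add: filterlim_at_top_dense)
  with assms(1,3) show "\<forall>\<^sub>F n in sequentially. real k * a n < b n"
    by eventually_elim simp
qed

lemma power_fun_apply: "(f ^ k) x = f x ^ k"
  for f :: "'a \<Rightarrow> 'b::monoid_mult"
  by (induction k) simp_all

lemma filterlim_seq_N: "filterlim seq_N at_top sequentially"
  unfolding seq_N_def by (rule filterlim_real_sequentially)

lemma seq_N_power_inf_smaller: "seq_N ^ k \<lless> seq_N ^ Suc k"
proof (rule inf_smaller_unbounded_mult[OF _ filterlim_seq_N])
  show "\<forall>\<^sub>F n in sequentially. (seq_N ^ k) n > 0"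
    using eventually_gt_at_top[of 0]
    by eventually_elim (simp add: power_fun_apply seq_N_def)
qed simp

lemma seq_P_inf_smaller_seq_S: "seq_P \<lless> seq_S"
proof (rule inf_smaller_unbounded_mult)
  show "\<forall>\<^sub>F n in sequentially. seq_P n > 0"
    using eventually_gt_at_top[of 0] by eventually_elim (simp add: seq_P_def)
  show "filterlim (\<lambda>n. (2 * real n + 1) / 3) at_top sequentially"
    \<comment> \<open>The factor dominates \<open>2 / 3 * real n\<close>, which is
      unbounded.\<close>
    by (rule filterlim_at_top_mono[OF filterlim_tendsto_pos_mult_at_top
          [OF tendsto_const[of "2 / 3"] _ filterlim_real_sequentially]]) auto
  show "\<forall>\<^sub>F n in sequentially. seq_S n = (2 * real n + 1) / 3 * seq_P n"
    by (simp add: seq_S_def seq_P_def)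
qed

text \<open>At every index, \<open>min n m = n - max (n - m) 0\<close> over the reals.\<close>

lemma seq_bar_eq_F: "seq_bar m =\<^sub>F seq_N - seq_N_omit m"
  by (simp add: eq_F_iff seq_bar_def seq_N_def seq_N_omit_def min_def max_def)

text \<open>Shifting the index by one turns the sum over \<open>1..n\<close> into the finite
  geometric sum of \<open>e ^ i\<close> over \<open>i < n\<close>.\<close>

lemma geometric_partial_sums:
  assumes "e \<noteq> 1"
  shows "partial_sums (\<lambda>i. e ^ (i - 1)) n = (1 - e ^ n) / (1 - e)"
  using assms by (simp add: partial_sums_def sum.atLeast1_atMost_eq sum_gp_strict)

lemma geometric_inf_close:
  assumes "\<bar>e\<bar> < 1"
  shows "(\<lambda>n. (1 - e ^ n) / (1 - e)) \<doteq> const_seq (1 / (1 - e))"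
  unfolding inf_close_def
proof (rule LIMSEQ_0_imp_infinitely_small)
  have "(\<lambda>n. (1 - e ^ n) / (1 - e) - 1 / (1 - e)) \<longlonglongrightarrow> (1 - 0) / (1 - e) - 1 / (1 - e)"
    using assms by (intro tendsto_intros LIMSEQ_power_zero) auto
  then show "(\<lambda>n. (1 - e ^ n) / (1 - e)) - const_seq (1 / (1 - e)) \<longlonglongrightarrow> 0"
    by (simp add: fun_diff_def const_seq_def)
qed

lemma quotient_multiples_seq_N:
  "(const_seq r * seq_N) / (const_seq s * seq_N) =\<^sub>F const_seq (r / s)"
  \<comment> \<open>For positive \<open>n\<close> the common factor \<open>n\<close>
    cancels.\<close>
  unfolding eq_F_iff using eventually_gt_at_top[of 0]
  by eventually_elim (simp add: const_seq_def seq_N_def)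

theorem theorem5:
  shows
    "(\<forall>m::nat. m \<ge> 1 \<longrightarrow> seq_bar m =\<^sub>F seq_N - seq_N_omit m) \<and>
     (\<forall>e::real. 0 < e \<and> e < 1 \<longrightarrow>
        (\<forall>n\<ge>1. partial_sums (\<lambda>i. e ^ (i - 1)) n = (1 - e ^ n) / (1 - e)) \<and>
        (\<lambda>n. (1 - e ^ n) / (1 - e)) \<doteq> const_seq (1 / (1 - e))) \<and>
     (seq_P <\<^sub>F seq_S \<and> seq_S \<ggreater> seq_P) \<and>
     ((\<forall>r s :: real. s \<noteq> 0 \<longrightarrow>
         (const_seq r * seq_N) / (const_seq s * seq_N) =\<^sub>F const_seq (r / s)) \<and>
      seq_N ^ 2 \<ggreater> seq_N \<and> seq_N ^ 3 \<ggreater> seq_N ^ 2)"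
proof (intro conjI allI impI)
  show "seq_N ^ 2 \<ggreater> seq_N" "seq_N ^ 3 \<ggreater> seq_N ^ 2"
    using seq_N_power_inf_smaller[of 1] seq_N_power_inf_smaller[of 2]
    by (simp_all only: power_one_right Suc_1 eval_nat_numeral BitM.simps)
\<comment> \<open>\<open>[simplified]\<close> rewrites \<open>i - 1\<close> to
  \<open>i - Suc 0\<close>, the form in which \<open>auto\<close> leaves the goal.\<close>
qed (auto intro: seq_bar_eq_F geometric_partial_sums[simplified] geometric_inf_close
  seq_P_inf_smaller_seq_S inf_smaller_imp_less_F quotient_multiples_seq_N)

end
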